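(* Let $A_1,A_2$ be $n$-dimensional algebras and let $K:A_1\to A_2$ be an algebra isomorphism (identified with its matrix). For $s_1\in A_1$ put $s_2=Ks_1$. Then for all $s_1$ in an open ball centered at $\mathbf{1}_{A_1}$ consisting only of units, the following two collections of (path-independent) line integrals coincide: $$\Big\{\int_{\mathbf{1}_{A_1}}^{s_1}[L_1t_1^{-1}]\cdot\mathbf{d}t_1:\ L_1\in\mathfrak{u}_{A_1}\Big\}=\Big\{\int_{\mathbf{1}_{A_2}}^{s_2}[L_2t_2^{-1}]\cdot\mathbf{d}t_2:\ L_2\in\mathfrak{u}_{A_2}\Big\}.$$
   Context: An "algebra" is a real finite-dimensional unital associative algebra with underlying vector space $\mathbb{R}^n$, standard basis and topology, elements as column vectors $s=(x_1,\dots,x_n)^T$, $\mathbf{d}s=(dx_1,\dots,dx_n)^T$, and "$\cdot$" the Euclidean dot product. An uncurling metric of $A$ is a real symmetric $n\times n$ matrix $L$ with $d\big((s^{-1})^TL\,\mathbf{d}s\big)=0$ on an open ball centered at $\mathbf{1}_A$ consisting only of units; the anti-rotor $\mathfrak{u}_A$ is the vector space of all uncurling metrics. For $L\in\mathfrak{u}_A$ the integral $\int_{\mathbf{1}}^{s}[Lt^{-1}]\cdot\mathbf{d}t$ is path-independent within such a ball. *)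

theory Defs
  imports "HOL-Analysis.Analysis"
begin

text \<open>An n-dimensional algebra: a real unital associative algebra structure on
  the vector space real^'n, given by a bilinear associative multiplication
  with two-sided unit.\<close>
definition is_algebra :: "(real^'n \<Rightarrow> real^'n \<Rightarrow> real^'n) \<Rightarrow> real^'n \<Rightarrow> bool" where
  "is_algebra m e \<longleftrightarrow> bilinear m \<and>
     (\<forall>x y z. m (m x y) z = m x (m y z)) \<and>
     (\<forall>x. m e x = x \<and> m x e = x)"

definition alg_units :: "(real^'n \<Rightarrow> real^'n \<Rightarrow> real^'n) \<Rightarrow> real^'n \<Rightarrow> (real^'n) set" where
  "alg_units m e = {s. \<exists>t. m s t = e \<and> m t s = e}"

definition alg_inv :: "(real^'n \<Rightarrow> real^'n \<Rightarrow> real^'n) \<Rightarrow> real^'n \<Rightarrow> real^'n \<Rightarrow> real^'n" where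
  "alg_inv m e s = (SOME t. m s t = e \<and> m t s = e)"

text \<open>The 1-form  omega(s) = (s^-1)^T L ds  with coefficient (row) vector
  (s^-1)^T L is closed at s: it is differentiable at s and its exterior
  derivative vanishes, i.e. d_j omega_i = d_i omega_j for all i, j.\<close>
definition closed_form_at :: "(real^'n \<Rightarrow> real^'n) \<Rightarrow> real^'n \<Rightarrow> bool" where
  "closed_form_at w s \<longleftrightarrow> (\<exists>D. (w has_derivative D) (at s) \<and>
       (\<forall>i j. D (axis j 1) $ i = D (axis i 1) $ j))"

definition uncurling_metric ::
  "(real^'n \<Rightarrow> real^'n \<Rightarrow> real^'n) \<Rightarrow> real^'n \<Rightarrow> real^'n^'n \<Rightarrow> bool" where
  "uncurling_metric m e L \<longleftrightarrow> transpose L = L \<and>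
     (\<exists>r>0. ball e r \<subseteq> alg_units m e \<and>
        (\<forall>s\<in>ball e r. closed_form_at (\<lambda>t. alg_inv m e t v* L) s))"

text \<open>The anti-rotor: the set (vector space) of all uncurling metrics.\<close>
definition anti_rotor :: "(real^'n \<Rightarrow> real^'n \<Rightarrow> real^'n) \<Rightarrow> real^'n \<Rightarrow> (real^'n^'n) set" where
  "anti_rotor m e = {L. uncurling_metric m e L}"

text \<open>Line integral of the vector field f along the straight segment from a to b
  (path-independent within the balls considered, which are convex).\<close>
definition seg_line_integral :: "(real^'n \<Rightarrow> real^'n) \<Rightarrow> real^'n \<Rightarrow> real^'n \<Rightarrow> real" where
  "seg_line_integral f a b = integral {0..1} (\<lambda>t. f (a + t *\<^sub>R (b - a)) \<bullet> (b - a))"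

text \<open>Algebra isomorphism given by its matrix K.\<close>
definition alg_iso ::
  "(real^'n \<Rightarrow> real^'n \<Rightarrow> real^'n) \<Rightarrow> real^'n \<Rightarrow> (real^'n \<Rightarrow> real^'n \<Rightarrow> real^'n) \<Rightarrow> real^'n
    \<Rightarrow> real^'n^'n \<Rightarrow> bool" where
  "alg_iso m1 e1 m2 e2 K \<longleftrightarrow> invertible K \<and> K *v e1 = e2 \<and>
     (\<forall>x y. K *v m1 x y = m2 (K *v x) (K *v y))"

end

theory Submission
  imports Defs
begin

text \<open>An algebra isomorphism \<open>K\<close> commutes with inversion, \<open>K (s\<^sup>-\<^sup>1) = (K s)\<^sup>-\<^sup>1\<close>.
  Hence the form \<open>(t\<^sup>-\<^sup>1)\<^sup>T L' dt\<close> of the congruent matrix \<open>L' = K\<^sup>-\<^sup>T L K\<^sup>-\<^sup>1\<close> on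
  \<open>A\<^sub>2\<close> is the pullback along the linear map \<open>K\<^sup>-\<^sup>1\<close> of the form of \<open>L\<close> on \<open>A\<^sub>1\<close>.
  Pullbacks along linear maps preserve closedness, so \<open>L \<mapsto> L'\<close> maps uncurling
  metrics to uncurling metrics, and by the change of variables \<open>t\<^sub>2 = K t\<^sub>1\<close> the
  line integral of the new form over \<open>[1, K s]\<close> equals that of the old one over
  \<open>[1, s]\<close>. Applying this to \<open>K\<close> and to \<open>K\<^sup>-\<^sup>1\<close> gives both inclusions.\<close>

lemma alg_units_alg_inv:
  assumes "s \<in> alg_units m e"
  shows "m s (alg_inv m e s) = e" "m (alg_inv m e s) s = e"
  using someI_ex[of "\<lambda>t. m s t = e \<and> m t s = e"] assms
  unfolding alg_units_def alg_inv_def by blast+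

lemma alg_inv_eqI:
  assumes "is_algebra m e" "m s t = e" "m t s = e"
  shows "alg_inv m e s = t"
proof -
  have assoc: "\<And>x y z. m (m x y) z = m x (m y z)" and unit: "\<And>x. m e x = x \<and> m x e = x"
    using assms(1) unfolding is_algebra_def by auto
  have "s \<in> alg_units m e" using assms unfolding alg_units_def by blast
  note u = alg_units_alg_inv[OF this]
  have "t = m t (m s (alg_inv m e s))" using u unit by simp
  also have "\<dots> = alg_inv m e s" using assoc assms(3) unit by (metis u(1))
  finally show ?thesis by simp
qed

lemma alg_iso_alg_units:
  assumes "alg_iso m1 e1 m2 e2 K" "s \<in> alg_units m1 e1"
  shows "K *v s \<in> alg_units m2 e2"
proof -
  obtain t where "m1 s t = e1" "m1 t s = e1" using assms(2) unfolding alg_units_def by blast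
  then have "m2 (K *v s) (K *v t) = e2" "m2 (K *v t) (K *v s) = e2"
    using assms(1) unfolding alg_iso_def by metis+
  then show ?thesis unfolding alg_units_def by blast
qed

lemma alg_iso_alg_inv:
  assumes "is_algebra m2 e2" "alg_iso m1 e1 m2 e2 K" "s \<in> alg_units m1 e1"
  shows "alg_inv m2 e2 (K *v s) = K *v alg_inv m1 e1 s"
proof (rule alg_inv_eqI[OF assms(1)])
  have "K *v e1 = e2" "\<And>x y. K *v m1 x y = m2 (K *v x) (K *v y)"
    using assms(2) unfolding alg_iso_def by auto
  then show "m2 (K *v s) (K *v alg_inv m1 e1 s) = e2" "m2 (K *v alg_inv m1 e1 s) (K *v s) = e2"
    using alg_units_alg_inv[OF assms(3)] by metis+
qed

lemma alg_iso_inverse: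
  assumes "alg_iso m1 e1 m2 e2 K" "Ki ** K = mat 1" "K ** Ki = mat 1"
  shows "alg_iso m2 e2 m1 e1 Ki"
proof -
  have "Ki *v (K *v x) = x" "K *v (Ki *v x) = x" for x
    using assms(2,3) by (simp_all add: matrix_vector_mul_assoc)
  then show ?thesis
    using assms unfolding alg_iso_def invertible_def by metis
qed

lemma linear_symmetric_iff_axis:
  fixes D :: "real^'n \<Rightarrow> real^'n"
  assumes "linear D"
  shows "(\<forall>i j. D (axis j 1) $ i = D (axis i 1) $ j) \<longleftrightarrow> (\<forall>x y. D x \<bullet> y = D y \<bullet> x)"
proof
  have D: "matrix D *v x = D x" for x
    using assms by (simp add: matrix_works linear_matrix_vector_mul_eq)
  assume "\<forall>i j. D (axis j 1) $ i = D (axis i 1) $ j"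
  then have sym: "transpose (matrix D) = matrix D"
    unfolding matrix_def transpose_def vec_eq_iff by auto
  show "\<forall>x y. D x \<bullet> y = D y \<bullet> x"
  proof (intro allI)
    fix x y
    have "D x \<bullet> y = (x v* matrix D) \<bullet> y"
      by (metis sym D transpose_matrix_vector)
    also have "\<dots> = D y \<bullet> x"
      by (metis dot_lmul_matrix D inner_commute)
    finally show "D x \<bullet> y = D y \<bullet> x" .
  qed
next
  assume "\<forall>x y. D x \<bullet> y = D y \<bullet> x"
  then show "\<forall>i j. D (axis j 1) $ i = D (axis i 1) $ j"
    by (metis inner_axis inner_real_def mult.right_neutral)
qed

lemma closed_form_at_iff_symmetric_derivative:
  "closed_form_at w s \<longleftrightarrow>
     (\<exists>D. (w has_derivative D) (at s) \<and> (\<forall>x y. D x \<bullet> y = D y \<bullet> x))"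
  unfolding closed_form_at_def
  using linear_symmetric_iff_axis has_derivative_linear by metis

lemma closed_form_at_linear_pullback:
  fixes A :: "real^'n^'n"
  assumes "closed_form_at w (A *v s)"
  shows "closed_form_at (\<lambda>x. transpose A *v w (A *v x)) s"
proof -
  obtain D where D: "(w has_derivative D) (at (A *v s))" and sym: "\<And>x y. D x \<bullet> y = D y \<bullet> x"
    using assms unfolding closed_form_at_iff_symmetric_derivative by blast
  have "((\<lambda>x. transpose A *v w (A *v x)) has_derivative (\<lambda>x. transpose A *v D (A *v x))) (at s)"
    using bounded_linear.has_derivative[OF matrix_vector_mul_bounded_linear
        has_derivative_compose[OF bounded_linear.has_derivative[OF matrix_vector_mul_bounded_linear
          has_derivative_ident] D]] .
  moreover have "(transpose A *v D (A *v x)) \<bullet> y = (transpose A *v D (A *v y)) \<bullet> x" for x y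
    using sym by (simp add: dot_lmul_matrix)
  ultimately show ?thesis unfolding closed_form_at_iff_symmetric_derivative by blast
qed

lemma closed_form_at_transform_within_open:
  assumes "closed_form_at w s" "open S" "s \<in> S" "\<And>x. x \<in> S \<Longrightarrow> w x = w' x"
  shows "closed_form_at w' s"
  using assms has_derivative_transform_within_open unfolding closed_form_at_def by metis

lemma congruence_mult_cancel:
  assumes "Ki ** K = mat 1"
  shows "(transpose Ki ** L ** Ki) *v (K *v y) = transpose Ki *v (L *v y)"
proof -
  have "transpose Ki ** L ** Ki ** K = transpose Ki ** L"
    by (metis assms matrix_mul_assoc matrix_mul_rid)
  then show ?thesis by (simp add: matrix_vector_mul_assoc)
qed

lemma anti_rotor_alg_iso:
  assumes "is_algebra m2 e2" "alg_iso m1 e1 m2 e2 K" "Ki ** K = mat 1" "K ** Ki = mat 1"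
    and "L \<in> anti_rotor m1 e1"
  shows "transpose Ki ** L ** Ki \<in> anti_rotor m2 e2"
proof -
  obtain r where "r > 0" and units: "ball e1 r \<subseteq> alg_units m1 e1"
    and closed: "\<forall>s\<in>ball e1 r. closed_form_at (\<lambda>t. alg_inv m1 e1 t v* L) s"
    and symL: "transpose L = L"
    using assms(5) unfolding anti_rotor_def uncurling_metric_def by blast
  define L' where "L' = transpose Ki ** L ** Ki"
  have symL': "transpose L' = L'"
    unfolding L'_def by (simp add: matrix_transpose_mul symL matrix_mul_assoc)
  define U where "U = (\<lambda>t. Ki *v t) -` ball e1 r"
  have "open U"
    unfolding U_def by (intro continuous_open_vimage open_ball linear_continuous_at) simp
  moreover have "e2 \<in> U"
    using alg_iso_inverse[OF assms(2-4)] \<open>r > 0\<close> unfolding U_def alg_iso_def by simp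
  ultimately obtain r' where "r' > 0" and ball_U: "ball e2 r' \<subseteq> U"
    by (meson openE)
  have KKi: "K *v (Ki *v t) = t" for t
    using assms(4) by (simp add: matrix_vector_mul_assoc)
  have unit2: "t \<in> alg_units m2 e2" and
    pullback: "alg_inv m2 e2 t v* L' = transpose Ki *v (alg_inv m1 e1 (Ki *v t) v* L)"
    if "t \<in> U" for t
  proof -
    have unit1: "Ki *v t \<in> alg_units m1 e1" using that units unfolding U_def by blast
    show "t \<in> alg_units m2 e2" using alg_iso_alg_units[OF assms(2) unit1] KKi by simp
    have "alg_inv m2 e2 t v* L' = L' *v (K *v alg_inv m1 e1 (Ki *v t))"
      using alg_iso_alg_inv[OF assms(1,2) unit1] KKi symL' by (metis transpose_matrix_vector)
    also have "\<dots> = transpose Ki *v (alg_inv m1 e1 (Ki *v t) v* L)"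
      using congruence_mult_cancel[OF assms(3)] symL unfolding L'_def
      by (metis transpose_matrix_vector)
    finally show "alg_inv m2 e2 t v* L' = transpose Ki *v (alg_inv m1 e1 (Ki *v t) v* L)" .
  qed
  have closed': "closed_form_at (\<lambda>t. alg_inv m2 e2 t v* L') t" if "t \<in> U" for t
  proof -
    have "closed_form_at (\<lambda>x. transpose Ki *v (alg_inv m1 e1 (Ki *v x) v* L)) t"
      using closed that unfolding U_def by (intro closed_form_at_linear_pullback) simp
    then show ?thesis
      by (rule closed_form_at_transform_within_open[OF _ \<open>open U\<close> that]) (rule pullback[symmetric])
  qed
  have "ball e2 r' \<subseteq> alg_units m2 e2" using ball_U unit2 by blast
  moreover have "\<forall>s\<in>ball e2 r'. closed_form_at (\<lambda>t. alg_inv m2 e2 t v* L') s"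
    using ball_U closed' by blast
  ultimately have "L' \<in> anti_rotor m2 e2"
    unfolding anti_rotor_def uncurling_metric_def using symL' \<open>r' > 0\<close> by blast
  then show ?thesis unfolding L'_def .
qed

lemma seg_line_integral_cong:
  assumes "\<And>x. x \<in> closed_segment a b \<Longrightarrow> f x = g x"
  shows "seg_line_integral f a b = seg_line_integral g a b"
  unfolding seg_line_integral_def
proof (rule integral_cong)
  fix u :: real assume "u \<in> {0..1}"
  then have "a + u *\<^sub>R (b - a) \<in> closed_segment a b"
    unfolding in_segment by (intro exI[of _ u]) (auto simp: algebra_simps)
  then show "f (a + u *\<^sub>R (b - a)) \<bullet> (b - a) = g (a + u *\<^sub>R (b - a)) \<bullet> (b - a)"
    using assms by simp
qed

lemma seg_line_integral_linear_pullback: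
  assumes "Ki ** K = mat 1"
  shows "seg_line_integral (\<lambda>x. transpose Ki *v f (Ki *v x)) (K *v a) (K *v b)
       = seg_line_integral f a b"
proof -
  have KiK: "Ki *v (K *v x) = x" for x
    using assms by (simp add: matrix_vector_mul_assoc)
  have "(transpose Ki *v f (Ki *v (K *v a + u *\<^sub>R (K *v b - K *v a)))) \<bullet> (K *v b - K *v a)
      = f (a + u *\<^sub>R (b - a)) \<bullet> (b - a)" for u
  proof -
    have "K *v a + u *\<^sub>R (K *v b - K *v a) = K *v (a + u *\<^sub>R (b - a))"
      and "K *v b - K *v a = K *v (b - a)"
      by (simp_all add: matrix_vector_right_distrib matrix_vector_mult_diff_distrib
          matrix_vector_mult_scaleR)
    then show ?thesis by (simp add: dot_lmul_matrix KiK)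
  qed
  then show ?thesis unfolding seg_line_integral_def by presburger
qed

lemma seg_line_integral_alg_iso:
  assumes "is_algebra m2 e2" "alg_iso m1 e1 m2 e2 K" "Ki ** K = mat 1"
    and "closed_segment e1 s \<subseteq> alg_units m1 e1"
  shows "seg_line_integral (\<lambda>t. (transpose Ki ** L ** Ki) *v alg_inv m2 e2 t) e2 (K *v s)
       = seg_line_integral (\<lambda>t. L *v alg_inv m1 e1 t) e1 s"
proof -
  have "K *v e1 = e2" using assms(2) unfolding alg_iso_def by blast
  have "seg_line_integral (\<lambda>t. (transpose Ki ** L ** Ki) *v alg_inv m2 e2 t) (K *v e1) (K *v s)
      = seg_line_integral (\<lambda>x. transpose Ki *v (L *v alg_inv m1 e1 (Ki *v x))) (K *v e1) (K *v s)"
  proof (rule seg_line_integral_cong)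
    fix x assume "x \<in> closed_segment (K *v e1) (K *v s)"
    then obtain p where "p \<in> alg_units m1 e1" "x = K *v p"
      using closed_segment_linear_image[of "(*v) K" e1 s] assms(4) by auto
    then show "(transpose Ki ** L ** Ki) *v alg_inv m2 e2 x
        = transpose Ki *v (L *v alg_inv m1 e1 (Ki *v x))"
      using alg_iso_alg_inv[OF assms(1,2)] congruence_mult_cancel[OF assms(3)] assms(3)
      by (simp add: matrix_vector_mul_assoc)
  qed
  also have "\<dots> = seg_line_integral (\<lambda>t. L *v alg_inv m1 e1 t) e1 s"
    by (rule seg_line_integral_linear_pullback[OF assms(3)])
  finally show ?thesis using \<open>K *v e1 = e2\<close> by simp
qed

lemma alg_iso_line_integrals_subset:
  assumes "is_algebra m2 e2" "alg_iso m1 e1 m2 e2 K"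
    and "closed_segment e1 s \<subseteq> alg_units m1 e1"
  shows "{seg_line_integral (\<lambda>t. L1 *v alg_inv m1 e1 t) e1 s | L1. L1 \<in> anti_rotor m1 e1}
       \<subseteq> {seg_line_integral (\<lambda>t. L2 *v alg_inv m2 e2 t) e2 (K *v s) | L2. L2 \<in> anti_rotor m2 e2}"
proof -
  obtain Ki where Ki: "Ki ** K = mat 1" "K ** Ki = mat 1"
    using assms(2) unfolding alg_iso_def invertible_def by blast
  have "\<exists>L2 \<in> anti_rotor m2 e2. seg_line_integral (\<lambda>t. L1 *v alg_inv m1 e1 t) e1 s
      = seg_line_integral (\<lambda>t. L2 *v alg_inv m2 e2 t) e2 (K *v s)"
    if "L1 \<in> anti_rotor m1 e1" for L1
    using anti_rotor_alg_iso[OF assms(1,2) Ki that]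
      seg_line_integral_alg_iso[OF assms(1,2) Ki(1) assms(3), of L1] by metis
  then show ?thesis by blast
qed

theorem theorem3p3:
  fixes m1 m2 :: "real^'n \<Rightarrow> real^'n \<Rightarrow> real^'n"
    and e1 e2 :: "real^'n" and K :: "real^'n^'n" and r :: real and s1 :: "real^'n"
  assumes "is_algebra m1 e1" and "is_algebra m2 e2"
    and "alg_iso m1 e1 m2 e2 K"
    and "r > 0" and "ball e1 r \<subseteq> alg_units m1 e1"
    and "s1 \<in> ball e1 r"
  shows "{seg_line_integral (\<lambda>t. L1 *v alg_inv m1 e1 t) e1 s1 | L1. L1 \<in> anti_rotor m1 e1}
       = {seg_line_integral (\<lambda>t. L2 *v alg_inv m2 e2 t) e2 (K *v s1) | L2. L2 \<in> anti_rotor m2 e2}"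
proof -
  obtain Ki where Ki: "Ki ** K = mat 1" "K ** Ki = mat 1"
    using assms(3) unfolding alg_iso_def invertible_def by blast
  have "K *v e1 = e2" using assms(3) unfolding alg_iso_def by blast
  have seg1: "closed_segment e1 s1 \<subseteq> alg_units m1 e1"
    using closed_segment_subset[of e1 "ball e1 r" s1] assms(4-6) by auto
  then have seg2: "closed_segment e2 (K *v s1) \<subseteq> alg_units m2 e2"
    using closed_segment_linear_image[of "(*v) K" e1 s1] alg_iso_alg_units[OF assms(3)]
      \<open>K *v e1 = e2\<close> by auto
  have "Ki *v (K *v s1) = s1" using Ki by (simp add: matrix_vector_mul_assoc)
  then show ?thesis
    using alg_iso_line_integrals_subset[OF assms(2,3) seg1]
      alg_iso_line_integrals_subset[OF assms(1) alg_iso_inverse[OF assms(3) Ki] seg2]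
    by (intro equalityI) simp_all
qed

end
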